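(* Let $N\in\mathbb N$, $\alpha\in(0,N)$ and $p\ge1$. There exists a constant $C>0$ such that for every $a\in\mathbb R^N$ and every measurable $u:\mathbb R^N\to\mathbb R$ with $\int_{\mathbb R^N}|I_{\alpha/2}*|u|^p|^2<\infty$, $$\int_0^\infty\Bigl(\frac1{|B_\rho(a)|}\int_{B_\rho(a)}|u|^p\Bigr)^2\rho^{\alpha+N-1}\,\mathrm d\rho\le C\int_{\mathbb R^N}\bigl|I_{\alpha/2}*|u|^p\bigr|^2.$$
   Context: $\mathbb N$ denotes the positive integers. For $\alpha\in(0,N)$ the Riesz potential is $I_\alpha(x)=A_\alpha|x|^{-(N-\alpha)}$ for $x\in\mathbb R^N\setminus\{0\}$, with $A_\alpha=\frac{\Gamma((N-\alpha)/2)}{\Gamma(\alpha/2)\pi^{N/2}2^\alpha}$. $B_\rho(a)$ is the open ball of radius $\rho$ centered at $a$ and $|B_\rho(a)|$ its Lebesgue measure. *)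

theory Defs
  imports "HOL-Analysis.Analysis"
begin

definition riesz_const :: "nat \<Rightarrow> real \<Rightarrow> real" where
  "riesz_const N \<alpha> =
     Gamma ((real N - \<alpha>) / 2) / (Gamma (\<alpha> / 2) * pi powr (real N / 2) * 2 powr \<alpha>)"

text \<open>
  The kernel is only meaningful away from the origin; since \<open>0 powr _ = 0\<close> it is given the
  value \<open>0\<close> there, which no integral sees.
\<close>

definition riesz_potential :: "real \<Rightarrow> real ^ 'n \<Rightarrow> real" where
  "riesz_potential \<alpha> x =
     riesz_const CARD('n) \<alpha> * norm x powr (- (real CARD('n) - \<alpha>))"

text \<open>
  Convolution of nonnegative functions is defined everywhere, with values in \<open>[0, \<infinity>]\<close>.
\<close>

definition nn_convolution ::
  "(real ^ 'n \<Rightarrow> ennreal) \<Rightarrow> (real ^ 'n \<Rightarrow> ennreal) \<Rightarrow> real ^ 'n \<Rightarrow> ennreal" where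
  "nn_convolution f g x = (\<integral>\<^sup>+ y. f (x - y) * g y \<partial>lebesgue)"

definition riesz_energy :: "real \<Rightarrow> real \<Rightarrow> (real ^ 'n \<Rightarrow> real) \<Rightarrow> ennreal" where
  "riesz_energy \<alpha> p u =
     (\<integral>\<^sup>+ x. (nn_convolution (\<lambda>z. ennreal (riesz_potential (\<alpha> / 2) z))
                           (\<lambda>y. ennreal (\<bar>u y\<bar> powr p)) x)\<^sup>2 \<partial>lebesgue)"

definition ball_average :: "real \<Rightarrow> (real ^ 'n \<Rightarrow> real) \<Rightarrow> real ^ 'n \<Rightarrow> real \<Rightarrow> ennreal" where
  "ball_average p u a \<rho> =
     (\<integral>\<^sup>+ y \<in> ball a \<rho>. ennreal (\<bar>u y\<bar> powr p) \<partial>lebesgue) / emeasure lebesgue (ball a \<rho>)"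

end

theory Submission
  imports Defs
begin

text \<open>
  Write \<open>f\<close> for \<open>\<bar>u\<bar> powr p\<close>, \<open>m r\<close> for the integral of \<open>f\<close> over the ball of radius \<open>r\<close> around
  \<open>a\<close>, and \<open>v\<close> for the Riesz potential of order \<open>\<alpha>/2\<close> of \<open>f\<close>. If \<open>dist a x = r\<close>, every point of
  that ball is closer than \<open>2r\<close> to \<open>x\<close>. Keeping only the part of the convolution that lives on the
  ball gives the pointwise bound \<open>v x \<ge> A (2r) powr (\<alpha>/2 - N) * m r\<close>
  (\<open>nn_convolution_riesz_potential_ge\<close>).

  The right-hand side is a radial function of \<open>x\<close>, so the integral of its square is
  one-dimensional (\<open>nn_integral_radial\<close>), with integrand a constant multiple of
  \<open>(m r)^2 * r powr (\<alpha> - 2N) * r^(N-1)\<close>. The ball has volume a constant times \<open>r^N\<close>, so the squared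
  average times \<open>r powr (\<alpha> + N - 1)\<close> is also a constant multiple of \<open>(m r)^2 * r powr (\<alpha> - N - 1)\<close>.
  The two integrands therefore agree up to a constant that depends only on \<open>N\<close> and \<open>\<alpha>\<close>.
\<close>

text \<open>
  The Lebesgue measure of a ball is an explicit power of its radius, and differentiating it gives
  the density of the distance to the centre. This is the radial case of polar coordinates, and it
  avoids the surface measure on the sphere.
\<close>

lemma nn_integral_radial:
  fixes a :: "'a::euclidean_space" and g :: "real \<Rightarrow> ennreal"
  assumes [measurable]: "g \<in> borel_measurable borel"
  shows "(\<integral>\<^sup>+ x. g (dist a x) \<partial>lborel) =
    (\<integral>\<^sup>+ r \<in> {0<..}. g r * ennreal (real DIM('a) * unit_ball_vol DIM('a) * r ^ (DIM('a) - 1)) \<partial>lborel)"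
proof -
  define n where "n = DIM('a)"
  have n: "n > 0" by (simp add: n_def)
  define \<omega> where "\<omega> = unit_ball_vol (real n)"
  have \<omega>: "\<omega> > 0" by (simp add: \<omega>_def)
  let ?h = "\<lambda>r. ennreal (n * \<omega> * r ^ (n - 1)) * indicator {0<..} r"
  \<comment> \<open>Under \<open>dist a\<close>, the preimages of the generating rays \<open>{..<r}\<close> are the balls around \<open>a\<close>.\<close>
  have "distr lborel borel (dist a) = density lborel ?h"
  proof (rule measure_eqI_generator_eq[where E = "range lessThan" and A = "\<lambda>i. {..<real i}" and \<Omega> = UNIV])
    show "Int_stable (range (lessThan :: real \<Rightarrow> _))"
    proof (clarsimp simp: Int_stable_def)
      fix b d :: real
      have "{..<b} \<inter> {..<d} = {..<min b d}" by auto
      then show "{..<b} \<inter> {..<d} \<in> range lessThan" by blast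
    qed
    show "sets (distr lborel borel (dist a)) = sigma_sets UNIV (range lessThan)"
      by (simp add: borel_eq_lessThan eucl_lessThan)
    show "sets (density lborel ?h) = sigma_sets UNIV (range lessThan)"
      by (simp add: borel_eq_lessThan eucl_lessThan)
    show "(\<Union>i. {..<real i}) = UNIV"
      using reals_Archimedean2 by auto
    have ball: "emeasure (distr lborel borel (dist a)) {..<r} = emeasure lborel (ball a r)" for r
      by (subst emeasure_distr) (auto simp: ball_def vimage_def)
    show "emeasure (distr lborel borel (dist a)) {..<real i} \<noteq> \<infinity>" for i
      unfolding ball by (simp add: emeasure_ball)
    fix X :: "real set" assume "X \<in> range lessThan"
    then obtain r where X: "X = {..<r}" by auto
    have h: "emeasure (density lborel ?h) X = (\<integral>\<^sup>+ s. ?h s * indicator {..<r} s \<partial>lborel)"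
      unfolding X by (rule emeasure_density) auto
    show "emeasure (distr lborel borel (dist a)) X = emeasure (density lborel ?h) X"
    proof (cases "r \<ge> 0")
      case True
      have "emeasure (density lborel ?h) X = (\<integral>\<^sup>+ s. ?h s * indicator {..<r} s \<partial>lborel)" by (rule h)
      also have "\<dots> = (\<integral>\<^sup>+ s. ennreal (n * \<omega> * s ^ (n - 1)) * indicator {0..r} s \<partial>lborel)"
      proof (rule nn_integral_cong_AE)
        show "AE s in lborel. ?h s * indicator {..<r} s
            = ennreal (n * \<omega> * s ^ (n - 1)) * indicator {0..r} s"
          using AE_lborel_singleton[of 0] AE_lborel_singleton[of r]
          by eventually_elim (auto simp: indicator_def)
      qed
      also have "\<dots> = ennreal (\<omega> * r ^ n - \<omega> * 0 ^ n)"
        using True n \<omega>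
        by (intro nn_integral_FTC_Icc) (auto intro!: derivative_eq_intros)
      also have "\<dots> = emeasure lborel (ball a r)"
        using True n by (simp add: emeasure_ball n_def \<omega>_def)
      finally show ?thesis unfolding X ball by simp
    next
      case False
      have "emeasure (density lborel ?h) X = (\<integral>\<^sup>+ s. ?h s * indicator {..<r} s \<partial>lborel)" by (rule h)
      also have "\<dots> = (\<integral>\<^sup>+ s. 0 \<partial>(lborel :: real measure))"
        using False by (intro nn_integral_cong) (auto simp: indicator_def)
      finally have "emeasure (density lborel ?h) X = 0" by simp
      then show ?thesis using False unfolding X ball by (simp add: ball_empty)
    qed
  qed auto
  then have "(\<integral>\<^sup>+ x. g (dist a x) \<partial>lborel) = integral\<^sup>N (density lborel ?h) g"
    by (subst nn_integral_distr[of "dist a" _ borel, symmetric]) auto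
  then show ?thesis
    by (subst (asm) nn_integral_density) (auto simp: n_def \<omega>_def ac_simps)
qed

lemma borel_measurable_nn_integral_ball:
  fixes f :: "'a::euclidean_space \<Rightarrow> ennreal"
  shows "(\<lambda>r. \<integral>\<^sup>+ y \<in> ball a r. f y \<partial>lebesgue) \<in> borel_measurable borel" (is "?m \<in> _")
proof (rule borel_measurableI_greater)
  fix c
  \<comment> \<open>The integral increases with the radius, so its superlevel sets are intervals.\<close>
  have mono: "?m r \<le> ?m s" if "r \<le> s" for r s
    using that by (intro nn_integral_mono) (auto simp: indicator_def)
  have "is_interval {r. c < ?m r}"
    unfolding is_interval_1 using mono by (auto intro: less_le_trans)
  then show "{r \<in> space borel. c < ?m r} \<in> sets borel"
    by (simp add: real_interval_borel_measurable)
qed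

lemma riesz_const_pos:
  assumes "0 < \<alpha>" "\<alpha> < real N"
  shows "riesz_const N \<alpha> > 0"
  using assms by (simp add: riesz_const_def Gamma_real_pos)

text \<open>
  Points of the ball of radius \<open>dist a x\<close> around \<open>a\<close> lie within \<open>2 * dist a x\<close> of \<open>x\<close>, and the
  Riesz kernel decreases with the distance. As the open ball does not contain \<open>x\<close>, the convolution
  restricted to this ball never evaluates the kernel at the origin.
\<close>

lemma nn_convolution_riesz_potential_ge:
  fixes f :: "real ^ 'n \<Rightarrow> ennreal"
  assumes "0 < \<alpha>" "\<alpha> < real CARD('n)" and f[measurable]: "f \<in> borel_measurable lebesgue"
  defines "A \<equiv> riesz_const CARD('n) \<alpha>"
  shows "ennreal (A * (2 * dist a x) powr (- (real CARD('n) - \<alpha>)))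
           * (\<integral>\<^sup>+ y \<in> ball a (dist a x). f y \<partial>lebesgue)
         \<le> nn_convolution (\<lambda>z. ennreal (riesz_potential \<alpha> z)) f x"
proof -
  define r where "r = dist a x"
  have A: "A > 0" unfolding A_def by (rule riesz_const_pos) fact+
  have "ennreal (A * (2 * r) powr (- (real CARD('n) - \<alpha>))) * (\<integral>\<^sup>+ y \<in> ball a r. f y \<partial>lebesgue)
      = (\<integral>\<^sup>+ y \<in> ball a r. ennreal (A * (2 * r) powr (- (real CARD('n) - \<alpha>))) * f y \<partial>lebesgue)"
  proof -
    have "ball a r \<in> sets lebesgue" by simp
    then have "(\<lambda>y. f y * indicator (ball a r) y) \<in> borel_measurable lebesgue"
      by (intro borel_measurable_times_ennreal f borel_measurable_indicator)
    then show ?thesis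
      by (simp add: nn_integral_cmult mult.assoc)
  qed
  also have "\<dots> \<le> nn_convolution (\<lambda>z. ennreal (riesz_potential \<alpha> z)) f x"
    unfolding nn_convolution_def
  proof (intro nn_integral_mono)
    fix y
    show "ennreal (A * (2 * r) powr (- (real CARD('n) - \<alpha>))) * f y * indicator (ball a r) y
      \<le> ennreal (riesz_potential \<alpha> (x - y)) * f y"
    proof (cases "y \<in> ball a r")
      case True
      have "x \<noteq> y" using True by (auto simp: r_def)
      have "norm (x - y) \<le> 2 * r"
        using True dist_triangle[of x y a] by (auto simp: r_def dist_norm norm_minus_commute)
      then have "(2 * r) powr (- (real CARD('n) - \<alpha>)) \<le> norm (x - y) powr (- (real CARD('n) - \<alpha>))"
        using \<open>x \<noteq> y\<close> assms by (intro powr_mono2') auto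
      then show ?thesis
        using True A by (auto simp: riesz_potential_def A_def intro!: mult_right_mono ennreal_leI mult_left_mono)
    qed auto
  qed
  finally show ?thesis by (simp add: r_def)
qed

theorem proposition3p6:
  fixes \<alpha> p :: real
  assumes "0 < \<alpha>" and "\<alpha> < real CARD('n::finite)" and "1 \<le> p"
  shows "\<exists>C::real. C > 0 \<and>
    (\<forall>(a :: real ^ 'n) (u :: real ^ 'n \<Rightarrow> real).
       u \<in> borel_measurable lebesgue \<longrightarrow> riesz_energy \<alpha> p u < \<infinity> \<longrightarrow>
       (\<integral>\<^sup>+ \<rho> \<in> {0<..}. (ball_average p u a \<rho>)\<^sup>2
            * ennreal (\<rho> powr (\<alpha> + real CARD('n) - 1)) \<partial>lborel)
         \<le> ennreal C * riesz_energy \<alpha> p u)"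
proof -
  define N where "N = CARD('n)"
  have N: "N > 0" by (simp add: N_def)
  define A where "A = riesz_const N (\<alpha> / 2)"
  define \<omega> where "\<omega> = unit_ball_vol (real N)"
  define \<beta> where "\<beta> = - (real N - \<alpha> / 2)"
  define c where "c = (A * 2 powr \<beta>)\<^sup>2 * (N * \<omega>)"
  have A: "A > 0"
    unfolding A_def using assms by (intro riesz_const_pos) (auto simp: N_def)
  have \<omega>: "\<omega> > 0" by (simp add: \<omega>_def)
  have c: "c > 0" using A \<omega> N by (simp add: c_def)
  have "(\<integral>\<^sup>+ \<rho> \<in> {0<..}. (ball_average p u a \<rho>)\<^sup>2 * ennreal (\<rho> powr (\<alpha> + real CARD('n) - 1)) \<partial>lborel)
         \<le> ennreal (1 / (\<omega>\<^sup>2 * c)) * riesz_energy \<alpha> p u"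
    if [measurable]: "u \<in> borel_measurable lebesgue" for a and u :: "real ^ 'n \<Rightarrow> real"
  proof -
    define f where "f = (\<lambda>y. ennreal (\<bar>u y\<bar> powr p))"
    have [measurable]: "f \<in> borel_measurable lebesgue" by (simp add: f_def)
    define m where "m = (\<lambda>r. \<integral>\<^sup>+ y \<in> ball a r. f y \<partial>lebesgue)"
    have [measurable]: "m \<in> borel_measurable borel"
      unfolding m_def by (rule borel_measurable_nn_integral_ball)
    \<comment> \<open>Both sides of the claim are compared with this integral, in which all constants are dropped.\<close>
    define J where "J = (\<integral>\<^sup>+ r \<in> {0<..}. (m r)\<^sup>2 * ennreal (r powr (\<alpha> - real N - 1)) \<partial>lborel)"
    have "ennreal c * J = (\<integral>\<^sup>+ r \<in> {0<..}. (ennreal (A * (2 * r) powr \<beta>) * m r)\<^sup>2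
          * ennreal (real N * \<omega> * r ^ (N - 1)) \<partial>lborel)"
      unfolding J_def
    proof (subst nn_integral_cmult[symmetric], measurable, intro nn_integral_cong)
      fix r :: real
      show "ennreal c * ((m r)\<^sup>2 * ennreal (r powr (\<alpha> - real N - 1)) * indicator {0<..} r)
        = (ennreal (A * (2 * r) powr \<beta>) * m r)\<^sup>2 * ennreal (real N * \<omega> * r ^ (N - 1))
          * indicator {0<..} r"
      proof (cases "r > 0")
        case True
        have "r powr (\<alpha> - real N - 1) = r powr (\<beta> + \<beta> + real (N - 1))"
          using N by (simp add: \<beta>_def of_nat_diff algebra_simps)
        also have "\<dots> = (r powr \<beta>)\<^sup>2 * r ^ (N - 1)"
          using True by (simp only: powr_add powr_realpow power2_eq_square)
        finally have "c * r powr (\<alpha> - real N - 1)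
            = (A * (2 * r) powr \<beta>)\<^sup>2 * (real N * \<omega> * r ^ (N - 1))"
          using True by (simp add: c_def powr_mult power_mult_distrib)
        then have "ennreal c * ennreal (r powr (\<alpha> - real N - 1))
            = (ennreal (A * (2 * r) powr \<beta>))\<^sup>2 * ennreal (real N * \<omega> * r ^ (N - 1))"
          using True A c \<omega> by (simp add: ennreal_mult[symmetric] ennreal_power)
        then show ?thesis
          using True by (simp add: power_mult_distrib) (metis mult.assoc mult.commute)
      qed auto
    qed
    also have "\<dots> = (\<integral>\<^sup>+ x. (ennreal (A * (2 * dist a x) powr \<beta>) * m (dist a x))\<^sup>2 \<partial>lebesgue)"
      unfolding nn_integral_completion
      by (subst nn_integral_radial[where g = "\<lambda>r. (ennreal (A * (2 * r) powr \<beta>) * m r)\<^sup>2"])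
         (auto simp: N_def \<omega>_def)
    also have "\<dots> \<le> riesz_energy \<alpha> p u"
      unfolding riesz_energy_def f_def[symmetric]
    proof (intro nn_integral_mono power_mono)
      fix x
      show "ennreal (A * (2 * dist a x) powr \<beta>) * m (dist a x)
          \<le> nn_convolution (\<lambda>z. ennreal (riesz_potential (\<alpha> / 2) z)) f x"
        using nn_convolution_riesz_potential_ge[of "\<alpha> / 2" f a x] assms
        by (simp add: A_def \<beta>_def N_def m_def)
    qed auto
    finally have E: "ennreal c * J \<le> riesz_energy \<alpha> p u" .
    have "(\<integral>\<^sup>+ \<rho> \<in> {0<..}. (ball_average p u a \<rho>)\<^sup>2 * ennreal (\<rho> powr (\<alpha> + real CARD('n) - 1)) \<partial>lborel)
        = ennreal (1 / \<omega>\<^sup>2) * J"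
      unfolding J_def
    proof (subst nn_integral_cmult[symmetric], measurable, intro nn_integral_cong)
      fix r :: real
      show "(ball_average p u a r)\<^sup>2 * ennreal (r powr (\<alpha> + real CARD('n) - 1)) * indicator {0<..} r
        = ennreal (1 / \<omega>\<^sup>2) * ((m r)\<^sup>2 * ennreal (r powr (\<alpha> - real N - 1)) * indicator {0<..} r)"
      proof (cases "r > 0")
        case True
        have "ball_average p u a r = m r / ennreal (\<omega> * r ^ N)"
          using True by (simp add: ball_average_def m_def f_def emeasure_ball \<omega>_def N_def)
        also have "\<dots> = m r * ennreal (1 / (\<omega> * r ^ N))"
          using True \<omega> by (simp add: divide_ennreal_def inverse_ennreal inverse_eq_divide)
        finally have 1: "ball_average p u a r = m r * ennreal (1 / (\<omega> * r ^ N))" .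
        have "r powr (\<alpha> + real N - 1) = r powr (\<alpha> - real N - 1 + real N + real N)"
          by (simp add: algebra_simps)
        also have "\<dots> = r powr (\<alpha> - real N - 1) * (r ^ N)\<^sup>2"
          using True by (simp only: powr_add powr_realpow power2_eq_square mult.assoc)
        finally have "(1 / (\<omega> * r ^ N))\<^sup>2 * r powr (\<alpha> + real N - 1)
            = 1 / \<omega>\<^sup>2 * r powr (\<alpha> - real N - 1)"
          using True \<omega> by (simp add: field_simps)
        then have "(ennreal (1 / (\<omega> * r ^ N)))\<^sup>2 * ennreal (r powr (\<alpha> + real N - 1))
            = ennreal (1 / \<omega>\<^sup>2) * ennreal (r powr (\<alpha> - real N - 1))"
          using True \<omega> by (simp add: ennreal_mult[symmetric] ennreal_power)
        then show ?thesis
          using True unfolding 1 N_def[symmetric]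
          by (simp add: power_mult_distrib) (metis mult.assoc mult.commute)
      qed auto
    qed
    also have "\<dots> = ennreal (1 / (\<omega>\<^sup>2 * c)) * (ennreal c * J)"
      using c \<omega> by (simp add: mult.assoc[symmetric] ennreal_mult[symmetric])
    also have "\<dots> \<le> ennreal (1 / (\<omega>\<^sup>2 * c)) * riesz_energy \<alpha> p u"
      by (intro mult_left_mono E) auto
    finally show ?thesis .
  qed
  \<comment> \<open>The factor \<open>\<omega>\<^sup>2\<close> comes from the volume in the ball average, \<open>c\<close> from the kernel bound and
    from polar coordinates.\<close>
  then show ?thesis
    using c \<omega> by (intro exI[of _ "1 / (\<omega>\<^sup>2 * c)"]) auto
qed

end
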